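(* $\overline{\forall}_{\mathsf{is\_prime}}\,\mathsf{sieve}$ holds, i.e., for every $i$, every element of the finite list $\mathsf{idl}\,\mathsf{sieve}\,i$ satisfies $\mathsf{is\_prime}$.
   Context: $\mathsf{colist}\,A$ is the coinductive type with constructors $\bot$ and $\mathsf{cocons}\,a\,l$, ordered coinductively by $\bot\sqsubseteq l$ and $\mathsf{cocons}\,a\,l_1\sqsubseteq\mathsf{cocons}\,a\,l_2$ if $l_1\sqsubseteq l_2$; order-equivalent streams are assumed equal (axiom). $\mathsf{idl}\,s\,0=\mathsf{nil}$, $\mathsf{idl}\,\bot\,(i+1)=\mathsf{nil}$, $\mathsf{idl}(\mathsf{cocons}\,a\,s)(i+1)=\mathsf{cons}\,a\,(\mathsf{idl}\,s\,i)$. For monotone $h:\mathsf{list}\,A\to C$ (lists ordered by prefix), $\overline h(s):=\sup_i h(\mathsf{idl}\,s\,i)$ (chosen supremum). $\mathsf{fold}\,z\,f$: $\mathsf{nil}\mapsto z$, $\mathsf{cons}\,a\,l\mapsto f\,a\,(\mathsf{fold}\,z\,f\,l)$. $\mathsf{filter}\,f:=\overline{\mathsf{fold}\,\bot\,(\lambda a\,l.\,\text{if }f\,a\text{ then }\mathsf{cocons}\,a\,l\text{ else }l)}$. $\mathsf{nats}\,n:=\mathsf{cocons}\,n\,(\mathsf{nats}(n+1))$, $n:\mathbb{Z}$. $\mathsf{sieve\_aux}:=\overline{\mathsf{fold}\,\bot\,(\lambda n\,l.\,\mathsf{cocons}\,n\,(\mathsf{filter}\,(\lambda m.\,m\bmod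 n\ne0)\,l))}$, $\mathsf{sieve}:=\mathsf{sieve\_aux}(\mathsf{nats}\,2)$. $\mathsf{is\_prime}\,n:\iff 1<n\land\forall m,\ 1<m\to n\ne m\to n\bmod m\ne0$. For $P:A\to\mathbb{P}$, $\overline{\forall}_P\,s:\iff\forall i,\ \mathsf{fold}\,\top\,(\lambda a\,Q.\,P\,a\land Q)\,(\mathsf{idl}\,s\,i)$ (the cocontinuous extension into $\mathbb{P}$, whose infima are universals). *)

theory Defs
  imports "HOL-Library.Sublist"
begin

codatatype 'a colist = is_Bot: Bot | Cocons (chd: 'a) (ctl: "'a colist")

coinductive colist_le :: "'a colist \<Rightarrow> 'a colist \<Rightarrow> bool" where
  Bot: "colist_le Bot l"
| Cocons: "colist_le l1 l2 \<Longrightarrow> colist_le (Cocons a l1) (Cocons a l2)"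

inductive_simps colist_le_simps:
  "colist_le l Bot"
  "colist_le (Cocons a l1) l2"
  "colist_le (Cocons a l1) (Cocons b l2)"

lemma colist_le_refl: "colist_le l l"
proof (coinduction arbitrary: l)
  case colist_le
  then show ?case by (cases l) auto
qed

lemma colist_le_trans: "colist_le x y \<Longrightarrow> colist_le y z \<Longrightarrow> colist_le x z"
proof (coinduction arbitrary: x y z)
  case colist_le
  then show ?case by (cases x) (auto simp: colist_le_simps)
qed

text \<open>Order-equivalent colists are equal; in HOL this is provable by coinduction.\<close>

lemma colist_le_antisym: "colist_le x y \<Longrightarrow> colist_le y x \<Longrightarrow> x = y"
proof (coinduction arbitrary: x y)
  case Eq_colist
  then show ?case by (cases x; cases y) (auto simp: colist_le_simps)
qed

instantiation colist :: (type) order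
begin

definition less_eq_colist :: "'a colist \<Rightarrow> 'a colist \<Rightarrow> bool" where
  "x \<le> y \<longleftrightarrow> colist_le x y"

definition less_colist :: "'a colist \<Rightarrow> 'a colist \<Rightarrow> bool" where
  "x < y \<longleftrightarrow> x \<le> y \<and> \<not> y \<le> (x :: 'a colist)"

instance
  by standard
    (auto simp: less_eq_colist_def less_colist_def
      intro: colist_le_refl colist_le_trans colist_le_antisym)

end

text \<open>The chosen supremum: all non-bottom members of a chain share their head.
  The class axioms proved in the \<open>ccpo\<close> instance state that it is the least upper bound
  of every chain.\<close>

primcorec colist_Sup :: "'a colist set \<Rightarrow> 'a colist" where
  "colist_Sup A =
    (if \<forall>x\<in>A. x = Bot then Bot
     else Cocons (THE a. a \<in> chd ` (A - {Bot})) (colist_Sup (ctl ` (A - {Bot}))))"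

lemma chain_chd:
  assumes "Complete_Partial_Order.chain colist_le A" "Cocons a l \<in> A"
  shows "(THE b. b \<in> chd ` (A - {Bot})) = a"
proof (rule the_equality)
  show "a \<in> chd ` (A - {Bot})"
    using assms(2) by force
next
  fix b assume "b \<in> chd ` (A - {Bot})"
  then obtain x where x: "x \<in> A" "x \<noteq> Bot" "b = chd x" by auto
  then have "colist_le x (Cocons a l) \<or> colist_le (Cocons a l) x"
    using assms by (auto dest: chainD)
  with x show "b = a" by (cases x) (auto simp: colist_le_simps)
qed

lemma chain_ctl:
  assumes "Complete_Partial_Order.chain colist_le A"
  shows "Complete_Partial_Order.chain colist_le (ctl ` (A - {Bot}))"
proof (rule chainI)
  fix x y assume "x \<in> ctl ` (A - {Bot})" "y \<in> ctl ` (A - {Bot})"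
  then obtain x' y' where *: "x' \<in> A" "x' \<noteq> Bot" "x = ctl x'" "y' \<in> A" "y' \<noteq> Bot" "y = ctl y'"
    by auto
  then have "colist_le x' y' \<or> colist_le y' x'"
    using assms by (auto dest: chainD)
  with * show "colist_le x y \<or> colist_le y x"
    by (cases x'; cases y') (auto simp: colist_le_simps)
qed

lemma colist_Sup_Cocons:
  assumes "Complete_Partial_Order.chain colist_le A" "Cocons a l \<in> A"
  shows "colist_Sup A = Cocons a (colist_Sup (ctl ` (A - {Bot})))"
  using assms by (subst colist_Sup.code) (auto simp: chain_chd)

lemma colist_Sup_upper:
  assumes "Complete_Partial_Order.chain colist_le A" "x \<in> A"
  shows "colist_le x (colist_Sup A)"
  using assms
proof (coinduction arbitrary: x A)
  case (colist_le x A)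
  show ?case
  proof (cases x)
    case (Cocons a l)
    with colist_le have "l \<in> ctl ` (A - {Bot})" by force
    with Cocons colist_le show ?thesis
      by (auto simp: colist_Sup_Cocons intro!: chain_ctl)
  qed simp
qed

lemma colist_Sup_least:
  assumes "Complete_Partial_Order.chain colist_le A" "\<And>x. x \<in> A \<Longrightarrow> colist_le x z"
  shows "colist_le (colist_Sup A) z"
proof -
  have "\<forall>x\<in>A. colist_le x z" using assms(2) by blast
  with assms(1) show ?thesis
  proof (coinduction arbitrary: A z)
    case (colist_le A z)
    show ?case
    proof (cases "\<forall>x\<in>A. x = Bot")
      case True
      then show ?thesis by (subst (1) colist_Sup.code) simp
    next
      case False
      then obtain a l where al: "Cocons a l \<in> A" by (metis colist.exhaust)
      with colist_le(2) have "colist_le (Cocons a l) z" by blast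
      then obtain z' where z: "z = Cocons a z'"
        by (auto simp: colist_le_simps)
      have "colist_le x z'" if "x \<in> ctl ` (A - {Bot})" for x
      proof -
        from that obtain y where y: "y \<in> A" "y \<noteq> Bot" "x = ctl y" by auto
        with colist_le have "colist_le y z" by blast
        with y z show ?thesis by (cases y) (auto simp: colist_le_simps)
      qed
      with al z colist_le(1) show ?thesis
        by (auto simp: colist_Sup_Cocons intro!: chain_ctl)
    qed
  qed
qed

instantiation colist :: (type) ccpo
begin

definition Sup_colist :: "'a colist set \<Rightarrow> 'a colist" where
  "Sup A = colist_Sup A"

instance
proof -
  have le: "(\<le>) = (colist_le :: 'a colist \<Rightarrow> 'a colist \<Rightarrow> bool)"
    by (intro ext) (simp add: less_eq_colist_def)
  show "OFCLASS('a colist, ccpo_class)"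
    by standard (auto simp: le Sup_colist_def intro: colist_Sup_upper colist_Sup_least)
qed

end

fun idl :: "'a colist \<Rightarrow> nat \<Rightarrow> 'a list" where
  "idl s 0 = []"
| "idl Bot (Suc i) = []"
| "idl (Cocons a s) (Suc i) = a # idl s i"

text \<open>The continuous extension of a prefix-monotone map; for such \<open>h\<close> the set below is
  a chain (\<open>chain_cext\<close>). The folds extended in \<open>cofilter\<close> and \<open>sieve_aux\<close> are shown
  prefix-monotone in \<open>filter_fold_mono\<close> and \<open>sieve_fold_mono\<close>.\<close>

definition cext :: "('a list \<Rightarrow> 'c::ccpo) \<Rightarrow> 'a colist \<Rightarrow> 'c" where
  "cext h s = Sup (range (\<lambda>i. h (idl s i)))"

definition cofilter :: "('a \<Rightarrow> bool) \<Rightarrow> 'a colist \<Rightarrow> 'a colist" where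
  "cofilter f = cext (\<lambda>l. foldr (\<lambda>a l. if f a then Cocons a l else l) l Bot)"

primcorec nats :: "int \<Rightarrow> int colist" where
  "nats n = Cocons n (nats (n + 1))"

definition sieve_aux :: "int colist \<Rightarrow> int colist" where
  "sieve_aux = cext (\<lambda>l. foldr (\<lambda>n l. Cocons n (cofilter (\<lambda>m. m mod n \<noteq> 0) l)) l Bot)"

definition sieve :: "int colist" where
  "sieve = sieve_aux (nats 2)"

definition is_prime :: "int \<Rightarrow> bool" where
  "is_prime n \<longleftrightarrow> 1 < n \<and> (\<forall>m. 1 < m \<longrightarrow> n \<noteq> m \<longrightarrow> n mod m \<noteq> 0)"

definition coforall :: "('a \<Rightarrow> bool) \<Rightarrow> 'a colist \<Rightarrow> bool" where
  "coforall P s \<longleftrightarrow> (\<forall>i. foldr (\<lambda>a Q. P a \<and> Q) (idl s i) True)"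

lemma prefix_idl: "i \<le> j \<Longrightarrow> prefix (idl s i) (idl s j)"
proof (induction s i arbitrary: j rule: idl.induct)
  case (3 a s i)
  then show ?case by (cases j) auto
qed auto

lemma prefix_idl_mono: "s \<le> t \<Longrightarrow> prefix (idl s i) (idl t i)"
proof (induction s i arbitrary: t rule: idl.induct)
  case (3 a s i)
  then show ?case by (cases t) (auto simp: less_eq_colist_def colist_le_simps)
qed auto

lemma foldr_mono_prefix:
  fixes f :: "'a \<Rightarrow> 'b colist \<Rightarrow> 'b colist"
  assumes "\<And>a. mono (f a)" "prefix xs ys"
  shows "foldr f xs Bot \<le> foldr f ys Bot"
  using assms(2)
proof (induction xs arbitrary: ys)
  case Nil
  then show ?case by (simp add: less_eq_colist_def colist_le.Bot)
next
  case (Cons x xs)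
  then show ?case
    by (cases ys) (auto intro: monoD[OF assms(1)])
qed

lemma chain_cext:
  assumes "\<And>xs ys. prefix xs ys \<Longrightarrow> h xs \<le> h ys"
  shows "Complete_Partial_Order.chain (\<le>) (range (\<lambda>i. h (idl s i)))"
  by (rule chainI) (use assms prefix_idl nat_le_linear in blast)

lemma mono_cext:
  assumes h: "\<And>xs ys. prefix xs ys \<Longrightarrow> h xs \<le> h ys"
  shows "mono (cext h)"
proof (rule monoI)
  fix s t :: "'a colist" assume st: "s \<le> t"
  show "cext h s \<le> cext h t"
    unfolding cext_def
  proof (rule ccpo_Sup_least[OF chain_cext[OF h]], assumption)
    fix x assume "x \<in> range (\<lambda>i. h (idl s i))"
    then obtain i where "x = h (idl s i)" by blast
    then have "x \<le> h (idl t i)" using h prefix_idl_mono[OF st] by blast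
    also have "\<dots> \<le> Sup (range (\<lambda>i. h (idl t i)))"
      by (rule ccpo_Sup_upper[OF chain_cext[OF h]]) auto
    finally show "x \<le> Sup (range (\<lambda>i. h (idl t i)))" .
  qed
qed

lemma filter_fold_mono:
  assumes "prefix xs ys"
  shows "foldr (\<lambda>a l. if f a then Cocons a l else l) xs Bot
    \<le> foldr (\<lambda>a l. if f a then Cocons a l else l) ys Bot"
  using assms
  by (intro foldr_mono_prefix monoI) (auto simp: less_eq_colist_def colist_le_simps)

lemma mono_cofilter: "mono (cofilter f)"
  unfolding cofilter_def by (intro mono_cext filter_fold_mono)

lemma sieve_fold_mono:
  assumes "prefix xs ys"
  shows "foldr (\<lambda>n l. Cocons n (cofilter (\<lambda>m. m mod n \<noteq> 0) l)) xs Bot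
    \<le> foldr (\<lambda>n l. Cocons n (cofilter (\<lambda>m. m mod (n::int) \<noteq> 0) l)) ys Bot"
proof (rule foldr_mono_prefix[OF _ assms], rule monoI)
  fix a :: int and x y :: "int colist" assume "x \<le> y"
  then have "cofilter (\<lambda>m. m mod a \<noteq> 0) x \<le> cofilter (\<lambda>m. m mod a \<noteq> 0) y"
    by (rule monoD[OF mono_cofilter])
  then show "Cocons a (cofilter (\<lambda>m. m mod a \<noteq> 0) x) \<le> Cocons a (cofilter (\<lambda>m. m mod a \<noteq> 0) y)"
    by (simp add: less_eq_colist_def colist_le_simps)
qed

end

theory Submission
  imports Defs
begin

text \<open>Every finite approximant of the sieve is a finite list computed by ordinary list filtering.
  Because the fold filters by \<^emph>\<open>every\<close> number of the input, also by the composite ones, an element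
  that survives in such an approximant has no smaller divisor in the input list. Each element of a
  supremum of a chain already occurs in some member of the chain, so the claim passes from the
  approximants to the sieve itself.\<close>

text \<open>These are the finite elements of the domain. A continuous extension can be evaluated on
  them without a limit, so \<open>cofilter\<close> becomes list filtering there.\<close>

definition colist_of :: "'a list \<Rightarrow> 'a colist" where
  "colist_of xs = foldr Cocons xs Bot"

lemma colist_of_simps [simp]:
  "colist_of [] = Bot"
  "colist_of (x # xs) = Cocons x (colist_of xs)"
  by (simp_all add: colist_of_def)

lemma set_colist_of [simp]: "set_colist (colist_of xs) = set xs"
  by (induction xs) auto

lemma idl_colist_of [simp]: "idl (colist_of xs) i = take i xs"
proof (induction xs arbitrary: i)
  case Nil
  then show ?case by (cases i) auto
next
  case (Cons x xs)
  then show ?case by (cases i) auto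
qed

lemma coforall_iff: "coforall P s \<longleftrightarrow> (\<forall>i. \<forall>x\<in>set (idl s i). P x)"
proof -
  have "foldr (\<lambda>a Q. P a \<and> Q) xs True \<longleftrightarrow> (\<forall>x\<in>set xs. P x)" for xs
    by (induction xs) auto
  then show ?thesis by (simp add: coforall_def)
qed

text \<open>The approximants of \<open>colist_of xs\<close> are prefixes of \<open>xs\<close> and
  reach \<open>xs\<close> at index \<open>length xs\<close>, so the chain of their images attains
  its supremum.\<close>

lemma cext_colist_of:
  fixes h :: "'a list \<Rightarrow> 'c::ccpo"
  assumes h: "\<And>xs ys. prefix xs ys \<Longrightarrow> h xs \<le> h ys"
  shows "cext h (colist_of xs) = h xs"
proof (rule antisym)
  note chain = chain_cext[of h "colist_of xs", OF h]
  show "cext h (colist_of xs) \<le> h xs"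
    unfolding cext_def by (rule ccpo_Sup_least[OF chain]) (auto intro: h take_is_prefix)
  have "h xs = h (idl (colist_of xs) (length xs))" by simp
  then have "h xs \<in> range (\<lambda>i. h (idl (colist_of xs) i))" by blast
  then show "h xs \<le> cext h (colist_of xs)"
    unfolding cext_def by (intro ccpo_Sup_upper[OF chain])
qed

lemma cofilter_colist_of: "cofilter f (colist_of xs) = colist_of (filter f xs)"
proof -
  have "foldr (\<lambda>a l. if f a then Cocons a l else l) xs Bot = colist_of (filter f xs)"
    by (induction xs) auto
  then show ?thesis
    unfolding cofilter_def by (simp add: cext_colist_of filter_fold_mono)
qed

text \<open>All members other than \<open>Bot\<close> share the head of the supremum, and its tail
  is the supremum of the chain of their tails. The induction on the depth \<open>i\<close> thus
  moves to another chain, hence the arbitrary \<open>A\<close>.\<close>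

lemma set_idl_colist_Sup:
  assumes "Complete_Partial_Order.chain colist_le A" "x \<in> set (idl (colist_Sup A) i)"
  shows "\<exists>y\<in>A. x \<in> set_colist y"
  using assms
proof (induction i arbitrary: A)
  case (Suc i)
  show ?case
  proof (cases "\<forall>y\<in>A. y = Bot")
    case True
    then have "colist_Sup A = Bot" by (subst colist_Sup.code) simp
    with Suc.prems show ?thesis by simp
  next
    case False
    then obtain a l where al: "Cocons a l \<in> A" by (metis colist.exhaust)
    let ?T = "ctl ` (A - {Bot})"
    have "x = a \<or> x \<in> set (idl (colist_Sup ?T) i)"
      using Suc.prems al by (simp add: colist_Sup_Cocons)
    then show ?thesis
    proof
      assume "x = a"
      with al show ?thesis by force
    next
      assume "x \<in> set (idl (colist_Sup ?T) i)"
      with Suc.IH[OF chain_ctl[OF Suc.prems(1)]]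
      obtain y where "y \<in> A" "y \<noteq> Bot" "x \<in> set_colist (ctl y)" by blast
      then show ?thesis by (intro bexI[of _ y]) (cases y, auto)
    qed
  qed
qed simp

lemma set_idl_cext:
  fixes h :: "'a list \<Rightarrow> 'b colist"
  assumes "\<And>xs ys. prefix xs ys \<Longrightarrow> h xs \<le> h ys" "x \<in> set (idl (cext h s) i)"
  shows "\<exists>j. x \<in> set_colist (h (idl s j))"
proof -
  \<comment> \<open>The class order has to be identified with \<open>colist_le\<close>, in which the
    chains of \<open>set_idl_colist_Sup\<close> are phrased.\<close>
  have "(\<le>) = (colist_le :: 'b colist \<Rightarrow> 'b colist \<Rightarrow> bool)"
    by (intro ext) (simp add: less_eq_colist_def)
  then show ?thesis
    using chain_cext[of h s, OF assms(1)] assms(2) set_idl_colist_Sup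
    by (fastforce simp: cext_def Sup_colist_def)
qed

lemma idl_nats: "idl (nats n) i = [n..n + int i - 1]"
proof (induction i arbitrary: n)
  case (Suc i)
  have "idl (nats n) (Suc i) = n # idl (nats (n + 1)) i"
    by (subst nats.code) simp
  also have "\<dots> = [n..n + int (Suc i) - 1]"
    by (simp add: Suc.IH upto_rec1[of n] algebra_simps)
  finally show ?case .
qed simp

text \<open>A number filters only what follows it; whether it survives itself is decided by the
  filters of the numbers before it.\<close>

primrec list_sieve :: "int list \<Rightarrow> int list" where
  "list_sieve [] = []"
| "list_sieve (n # l) = n # filter (\<lambda>m. m mod n \<noteq> 0) (list_sieve l)"

lemma sieve_fold_eq_list_sieve:
  "foldr (\<lambda>n l. Cocons n (cofilter (\<lambda>m. m mod n \<noteq> 0) l)) l Bot = colist_of (list_sieve l)"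
  by (induction l) (auto simp: cofilter_colist_of)

text \<open>If \<open>x\<close> is the head, sortedness leaves no smaller \<open>m\<close> in the
  list. Otherwise \<open>x\<close> passed the filter of the head, and the induction hypothesis
  handles every \<open>m\<close> in the tail.\<close>

lemma list_sieve_no_smaller_divisor:
  assumes "sorted_wrt (<) l" "x \<in> set (list_sieve l)"
  shows "x \<in> set l \<and> (\<forall>m\<in>set l. m < x \<longrightarrow> x mod m \<noteq> 0)"
  using assms by (induction l) fastforce+

lemma is_prime_list_sieve:
  assumes "x \<in> set (list_sieve [2..k])"
  shows "is_prime x"
proof -
  have sieved: "x \<in> set [2..k]" "\<forall>m\<in>set [2..k]. m < x \<longrightarrow> x mod m \<noteq> 0"
    using list_sieve_no_smaller_divisor[OF sorted_wrt_upto assms] by auto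
  have "x mod m \<noteq> 0" if "1 < m" "x \<noteq> m" for m
  proof (cases "m < x")
    case True
    \<comment> \<open>As \<open>x\<close> is at most \<open>k\<close>, the smaller \<open>m\<close>
      lies in \<open>[2..k]\<close> too.\<close>
    with sieved that show ?thesis by auto
  next
    case False
    \<comment> \<open>A modulus above \<open>x\<close> leaves \<open>x\<close> unchanged, and
      \<open>x\<close> is at least 2.\<close>
    with sieved(1) that have "x mod m = x" by simp
    with sieved(1) show ?thesis by simp
  qed
  with sieved(1) show ?thesis by (simp add: is_prime_def)
qed

theorem mainTheorem8: "coforall is_prime sieve"
  unfolding coforall_iff
proof (intro allI ballI)
  fix i x assume "x \<in> set (idl sieve i)"
  \<comment> \<open>The index \<open>j\<close> is a depth of \<open>nats 2\<close> whose approximant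
    already yields \<open>x\<close>; it need not be \<open>i\<close>, since sieving drops
    numbers.\<close>
  then obtain j where "x \<in> set (list_sieve (idl (nats 2) j))"
    unfolding sieve_def sieve_aux_def
    using set_idl_cext[OF sieve_fold_mono] by (fastforce simp: sieve_fold_eq_list_sieve)
  then show "is_prime x"
    unfolding idl_nats by (rule is_prime_list_sieve)
qed

end
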